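(* Let $\Bbbk$ be a nonzero commutative ring. Let $A$ be a precise artinian local ring in $\mathsf{STRing}_{\mathrm{c}}\,\Bbbk$, with residue field $K$. Give $K$ the fine $A$-module topology. Then any lifting $\sigma:K\to A$ in $\mathsf{STRing}_{\mathrm{c}}\,\Bbbk$ is a precise lifting.
   Context: $\Bbbk$ carries the discrete topology. A $\Bbbk$-linear topology on a $\Bbbk$-module is a module topology in which $0$ has a basis of open neighborhoods consisting of $\Bbbk$-submodules. A commutative semi-topological (ST) $\Bbbk$-ring is a commutative $\Bbbk$-ring $A$ with a $\Bbbk$-linear topology such that for every $a\in A$ the map $A\to A$, $b\mapsto ab$, is continuous. These form the category $\mathsf{STRing}_{\mathrm{c}}\,\Bbbk$, with morphisms the continuous $\Bbbk$-ring homomorphisms. A ST $A$-module is an $A$-module $M$ with a $\Bbbk$-linear topology such that for every $a\in A$, $m\in M$ the maps $M\to M$, $m'\mapsto am'$, and $A\to M$, $a'\mapsto a'm$, are continuous. The fine $A$-module topology on an $A$-module is the finest $\Bbbk$-linear topology making it a ST $A$-module (it exists). Given a ring homomorphism $f:A\to B$ and a $B$-module $M$, the fine $(A,f)$-module topology on $M$ is the fine $A$-module topology on $M$ viewed as an $A$-module via $f$. Let $A$ be an artinian local ring in $\mathsf{STRing}_{\mathrm{c}}\,\Bbbk$ with residue field $K$, with $K$ given the fine $A$-module topology, and let $\pi:A\to K$ be the canonical surjection. A lifting is a continuous $\Bbbk$-ring homomorphism $\sigma:K\to A$ with $\pi\circ\sigma=\mathrm{id}_K$. The lifting $\sigma$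 is precise if the given topology of $A$ equals the fine $(K,\sigma)$-module topology on $A$. $A$ is a precise artinian local ring in $\mathsf{STRing}_{\mathrm{c}}\,\Bbbk$ if it admits some precise lifting. *)

theory Defs
  imports "HOL-Analysis.Analysis" "HOL-Algebra.QuotRing" "HOL-Algebra.Module"
begin

text \<open>
  A commutative \<open>k\<close>-ring is a commutative ring \<open>A\<close> with \<open>algebra k A\<close>; its structure map is
  \<open>c \<mapsto> c \<odot> \<one>\<close>. Topologies are values of type \<open>'a topology\<close> whose
  \<open>topspace\<close> is the carrier, since the same carrier has to be compared under several topologies.
\<close>

definition structure_map :: "('k, 'a) module \<Rightarrow> 'k \<Rightarrow> 'a" where
  "structure_map A c = c \<odot>\<^bsub>A\<^esub> \<one>\<^bsub>A\<^esub>"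

definition self_module :: "('a, 'x) ring_scheme \<Rightarrow> ('a, 'a) module" where
  "self_module R = \<lparr>carrier = carrier R, monoid.mult = monoid.mult R, one = one R, zero = zero R, add = add R,
     module.smult = monoid.mult R\<rparr>"

definition restrict_scalars :: "('a \<Rightarrow> 'b) \<Rightarrow> ('b, 'm) module \<Rightarrow> ('a, 'm) module" where
  "restrict_scalars f M = \<lparr>carrier = carrier M, monoid.mult = monoid.mult M, one = one M, zero = zero M,
     add = add M, module.smult = (\<lambda>a x. f a \<odot>\<^bsub>M\<^esub> x)\<rparr>"

definition linear_topology ::
    "('k, 'x) ring_scheme \<Rightarrow> ('k, 'm) module \<Rightarrow> 'm topology \<Rightarrow> bool" where
  "linear_topology k M T \<longleftrightarrow>
     Module.module k M \<and> topspace T = carrier M \<and>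
     continuous_map (prod_topology T T) T (\<lambda>(x, y). x \<oplus>\<^bsub>M\<^esub> y) \<and>
     continuous_map (prod_topology (discrete_topology (carrier k)) T) T (\<lambda>(c, x). c \<odot>\<^bsub>M\<^esub> x) \<and>
     (\<forall>U. openin T U \<and> \<zero>\<^bsub>M\<^esub> \<in> U \<longrightarrow> (\<exists>V. submodule V k M \<and> openin T V \<and> V \<subseteq> U))"

definition st_ring ::
    "('k, 'x) ring_scheme \<Rightarrow> ('k, 'a) module \<Rightarrow> 'a topology \<Rightarrow> bool" where
  "st_ring k A TA \<longleftrightarrow>
     algebra k A \<and> linear_topology k A TA \<and>
     (\<forall>a\<in>carrier A. continuous_map TA TA (\<lambda>b. a \<otimes>\<^bsub>A\<^esub> b))"

definition st_module ::
    "('k, 'x) ring_scheme \<Rightarrow> ('k, 'a) module \<Rightarrow> 'a topology \<Rightarrow> ('a, 'm) module \<Rightarrow> 'm topology \<Rightarrow> bool"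
  where
  "st_module k A TA M T \<longleftrightarrow>
     Module.module A M \<and> linear_topology k (restrict_scalars (structure_map A) M) T \<and>
     (\<forall>a\<in>carrier A. continuous_map T T (\<lambda>x. a \<odot>\<^bsub>M\<^esub> x)) \<and>
     (\<forall>x\<in>carrier M. continuous_map TA T (\<lambda>a. a \<odot>\<^bsub>M\<^esub> x))"

definition is_fine_module_topology ::
    "('k, 'x) ring_scheme \<Rightarrow> ('k, 'a) module \<Rightarrow> 'a topology \<Rightarrow> ('a, 'm) module \<Rightarrow> 'm topology \<Rightarrow> bool"
  where
  "is_fine_module_topology k A TA M T \<longleftrightarrow>
     st_module k A TA M T \<and>
     (\<forall>T'. st_module k A TA M T' \<longrightarrow> (\<forall>U. openin T' U \<longrightarrow> openin T U))"

definition fine_module_topology ::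
    "('k, 'x) ring_scheme \<Rightarrow> ('k, 'a) module \<Rightarrow> 'a topology \<Rightarrow> ('a, 'm) module \<Rightarrow> 'm topology" where
  "fine_module_topology k A TA M = (THE T. is_fine_module_topology k A TA M T)"

text \<open>The definite description above denotes: the fine topology exists and is unique.\<close>

lemma is_fine_module_topology_unique:
  "is_fine_module_topology k A TA M T \<Longrightarrow> is_fine_module_topology k A TA M T' \<Longrightarrow> T = T'"
  unfolding is_fine_module_topology_def by (metis topology_eq)

lemma restrict_scalars_sel [simp]:
  "carrier (restrict_scalars f M) = carrier M" "monoid.mult (restrict_scalars f M) = monoid.mult M"
  "one (restrict_scalars f M) = one M" "zero (restrict_scalars f M) = zero M"
  "add (restrict_scalars f M) = add M"
  "module.smult (restrict_scalars f M) = (\<lambda>a x. f a \<odot>\<^bsub>M\<^esub> x)"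
  by (simp_all add: restrict_scalars_def)

lemma structure_map_hom:
  assumes "algebra k A"
  shows "structure_map A \<in> ring_hom k A"
proof -
  interpret algebra k A by fact
  show ?thesis
  proof (rule ring_hom_memI)
    fix x y assume xy: "x \<in> carrier k" "y \<in> carrier k"
    have "(x \<odot>\<^bsub>A\<^esub> \<one>\<^bsub>A\<^esub>) \<otimes>\<^bsub>A\<^esub> (y \<odot>\<^bsub>A\<^esub> \<one>\<^bsub>A\<^esub>) = x \<odot>\<^bsub>A\<^esub> (y \<odot>\<^bsub>A\<^esub> \<one>\<^bsub>A\<^esub>)"
      using xy by (simp add: smult_assoc2)
    then show "structure_map A (x \<otimes>\<^bsub>k\<^esub> y) = structure_map A x \<otimes>\<^bsub>A\<^esub> structure_map A y"
      using xy by (simp add: structure_map_def smult_assoc1)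
  qed (auto simp: structure_map_def smult_l_distr)
qed

lemma module_restrict_scalars:
  assumes "cring R" "f \<in> ring_hom R S" "Module.module S M"
  shows "Module.module R (restrict_scalars f M)"
proof -
  interpret R: cring R by fact
  interpret M: Module.module S M by fact
  have ab: "abelian_group (restrict_scalars f M)"
  proof (rule abelian_groupI)
    fix x assume "x \<in> carrier (restrict_scalars f M)"
    then show "\<exists>y\<in>carrier (restrict_scalars f M).
        y \<oplus>\<^bsub>restrict_scalars f M\<^esub> x = \<zero>\<^bsub>restrict_scalars f M\<^esub>"
      by (auto intro!: bexI[of _ "\<ominus>\<^bsub>M\<^esub> x"] simp: M.M.l_neg)
  qed (auto simp: M.M.a_ac)
  show ?thesis
    using ring_hom_closed[OF assms(2)] ring_hom_mult[OF assms(2)] ring_hom_add[OF assms(2)]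
      ring_hom_one[OF assms(2)]
    by (intro moduleI assms(1) ab)
       (auto simp: M.smult_l_distr M.smult_r_distr M.smult_assoc1)
qed

lemma fine_module_topology_exists:
  fixes k :: "('k, 'x) ring_scheme" and A :: "('k, 'a) module" and M :: "('a, 'm) module"
  assumes "st_ring k A TA" and M: "Module.module A M"
  shows "\<exists>T. is_fine_module_topology k A TA M T"
proof -
  let ?N = "restrict_scalars (structure_map A) M"
  define \<T> where "\<T> = {T. st_module k A TA M T}"
  define S where "S = {U. \<exists>T\<in>\<T>. openin T U}"
  define T0 where "T0 = topology_generated_by S"
  have alg: "algebra k A" and topA: "topspace TA = carrier A"
    using assms(1) by (auto simp: st_ring_def linear_topology_def)
  interpret algebra k A by (fact alg)
  interpret M: Module.module A M by (fact M)
  interpret N: Module.module k ?N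
    by (rule module_restrict_scalars[OF R.cring_axioms structure_map_hom[OF alg] M])
  have N: "Module.module k ?N" ..
  have sc: "structure_map A c \<in> carrier A" if "c \<in> carrier k" for c
    using that by (simp add: structure_map_def)
  define Tt where "Tt = topology_generated_by {carrier M}"
  have topt: "topspace Tt = carrier M" by (simp add: Tt_def)
  have Tt: "continuous_map X Tt f" if "\<And>x. x \<in> topspace X \<Longrightarrow> f x \<in> carrier M" for X :: "'z topology" and f
  proof -
    have "f -` carrier M \<inter> topspace X = topspace X" using that by auto
    then show ?thesis unfolding Tt_def using that
      by (subst continuous_on_generated_topo_iff) auto
  qed
  have oTt: "U = {} \<or> U = carrier M" if "openin Tt U" for U
  proof -
    have "generate_topology_on {carrier M} U"
      using that openin_topology_generated_by unfolding Tt_def by blast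
    then show ?thesis by (induct rule: generate_topology_on.induct) blast+
  qed
  have carr_sub: "submodule (carrier M) k ?N"
    by (rule N.submoduleI) (use N.M.a_inv_closed N.M.a_closed N.smult_closed in auto)
  have "st_module k A TA M Tt"
    unfolding st_module_def linear_topology_def
  proof (intro conjI ballI allI impI)
    fix U assume "openin Tt U \<and> \<zero>\<^bsub>?N\<^esub> \<in> U"
    then have "U = carrier M" using oTt by auto
    then show "\<exists>V. submodule V k ?N \<and> openin Tt V \<and> V \<subseteq> U"
      using carr_sub topt by (metis openin_topspace order_refl)
  qed (auto intro!: Tt simp: M N topt topA sc)
  then have TtT: "Tt \<in> \<T>" by (simp add: \<T>_def)
  have top: "topspace T = carrier M" if "T \<in> \<T>" for T
    using that by (auto simp: \<T>_def st_module_def linear_topology_def)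
  have fin: "openin T0 U" if "T \<in> \<T>" "openin T U" for T U
    using that unfolding T0_def S_def by (intro topology_generated_by_Basis) auto
  have "U \<subseteq> carrier M" if "U \<in> S" for U
    using that top openin_subset unfolding S_def by fastforce
  moreover have "carrier M \<in> S"
    unfolding S_def using TtT topt openin_topspace by (metis (mono_tags, lifting) mem_Collect_eq)
  ultimately have US: "\<Union>S = carrier M" by blast
  have top0: "topspace T0 = carrier M" by (simp add: T0_def US)
  have id0: "continuous_map T0 T (\<lambda>x. x)" if "T \<in> \<T>" for T
    using that fin[OF that] top[OF that] top0
    by (metis topology_finer_continuous_id id_def continuous_map_eq)
  have into: "continuous_map X T0 f" if "\<And>T. T \<in> \<T> \<Longrightarrow> continuous_map X T f"
    for X :: "'z topology" and f
    unfolding T0_def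
  proof (subst continuous_on_generated_topo_iff, intro conjI allI impI)
    fix U assume "U \<in> S"
    then obtain T where T: "T \<in> \<T>" "openin T U" by (auto simp: S_def)
    have "{x \<in> topspace X. f x \<in> U} = f -` U \<inter> topspace X" by auto
    then show "openin X (f -` U \<inter> topspace X)"
      using openin_continuous_map_preimage[OF that[OF T(1)] T(2)] by simp
  next
    show "f ` topspace X \<subseteq> \<Union>S"
      using continuous_map_image_subset_topspace[OF that[OF TtT]] topt US by simp
  qed
  have props: "continuous_map (prod_topology T T) T (\<lambda>(x, y). x \<oplus>\<^bsub>M\<^esub> y)"
      "continuous_map (prod_topology (discrete_topology (carrier k)) T) T
         (\<lambda>(c, x). structure_map A c \<odot>\<^bsub>M\<^esub> x)"
      "\<And>a. a \<in> carrier A \<Longrightarrow> continuous_map T T (\<lambda>x. a \<odot>\<^bsub>M\<^esub> x)"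
      "\<And>x. x \<in> carrier M \<Longrightarrow> continuous_map TA T (\<lambda>a. a \<odot>\<^bsub>M\<^esub> x)"
      "\<And>U. openin T U \<Longrightarrow> \<zero>\<^bsub>M\<^esub> \<in> U \<Longrightarrow> \<exists>V. submodule V k ?N \<and> openin T V \<and> V \<subseteq> U"
    if "T \<in> \<T>" for T
    using that by (auto simp: \<T>_def st_module_def linear_topology_def)
  have "st_module k A TA M T0"
    unfolding st_module_def linear_topology_def restrict_scalars_sel
  proof (intro conjI ballI allI impI)
    show "continuous_map (prod_topology T0 T0) T0 (\<lambda>(x, y). x \<oplus>\<^bsub>M\<^esub> y)"
    proof (rule into)
      fix T assume T: "T \<in> \<T>"
      have "continuous_map (prod_topology T0 T0) (prod_topology T T) (\<lambda>(x, y). (x, y))"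
        using id0[OF T] by (subst continuous_map_prod_top) auto
      from continuous_map_compose[OF this props(1)[OF T]]
      show "continuous_map (prod_topology T0 T0) T (\<lambda>(x, y). x \<oplus>\<^bsub>M\<^esub> y)"
        by (simp add: o_def case_prod_unfold)
    qed
    show "continuous_map (prod_topology (discrete_topology (carrier k)) T0) T0
        (\<lambda>(c, x). structure_map A c \<odot>\<^bsub>M\<^esub> x)"
    proof (rule into)
      fix T assume T: "T \<in> \<T>"
      have "continuous_map (prod_topology (discrete_topology (carrier k)) T0)
              (prod_topology (discrete_topology (carrier k)) T) (\<lambda>(x, y). (x, y))"
        using id0[OF T] by (subst continuous_map_prod_top) auto
      from continuous_map_compose[OF this props(2)[OF T]]
      show "continuous_map (prod_topology (discrete_topology (carrier k)) T0) T
          (\<lambda>(c, x). structure_map A c \<odot>\<^bsub>M\<^esub> x)"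
        by (simp add: o_def case_prod_unfold)
    qed
    show "continuous_map T0 T0 (\<lambda>x. a \<odot>\<^bsub>M\<^esub> x)" if "a \<in> carrier A" for a
    proof (rule into)
      fix T assume T: "T \<in> \<T>"
      from continuous_map_compose[OF id0[OF T] props(3)[OF T that]]
      show "continuous_map T0 T (\<lambda>x. a \<odot>\<^bsub>M\<^esub> x)" by (simp add: o_def)
    qed
    show "continuous_map TA T0 (\<lambda>a. a \<odot>\<^bsub>M\<^esub> x)" if "x \<in> carrier M" for x
      using props(4)[OF _ that] by (intro into)
    fix U assume U: "openin T0 U \<and> \<zero>\<^bsub>M\<^esub> \<in> U"
    then have "generate_topology_on S U" "\<zero>\<^bsub>M\<^esub> \<in> U"
      using openin_topology_generated_by unfolding T0_def by auto
    then show "\<exists>V. submodule V k ?N \<and> openin T0 V \<and> V \<subseteq> U"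
    proof (induct rule: generate_topology_on.induct)
      case (Int a b)
      then obtain V W where V: "submodule V k ?N" "openin T0 V" "V \<subseteq> a"
        and W: "submodule W k ?N" "openin T0 W" "W \<subseteq> b" by auto
      have "submodule (V \<inter> W) k ?N"
      proof (rule N.submoduleI)
        show "V \<inter> W \<subseteq> carrier ?N" using N.submoduleE(1)[OF V(1)] by blast
        show "\<zero>\<^bsub>?N\<^esub> \<in> V \<inter> W"
          using subgroup.one_closed[OF submodule.axioms(1)[OF V(1)]]
            subgroup.one_closed[OF submodule.axioms(1)[OF W(1)]] by simp
      qed (simp_all add: N.submoduleE[OF V(1), simplified] N.submoduleE[OF W(1), simplified])
      moreover have "openin T0 (V \<inter> W)" "V \<inter> W \<subseteq> a \<inter> b" using V W by auto
      ultimately show ?case by blast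
    next
      case (Basis U)
      then obtain T where T: "T \<in> \<T>" "openin T U" by (auto simp: S_def)
      from props(5)[OF this Basis(2)] obtain V where "submodule V k ?N" "openin T V" "V \<subseteq> U"
        by auto
      then show ?case using fin[OF T(1)] by auto
    next
      case (UN K)
      then obtain U where "U \<in> K" "\<zero>\<^bsub>M\<^esub> \<in> U" by auto
      from UN(2)[OF this] obtain V where "submodule V k ?N" "openin T0 V" "V \<subseteq> U" by auto
      then show ?case using \<open>U \<in> K\<close> by (intro exI[of _ V]) auto
    qed simp
  qed (use N top0 M in auto)
  then have "is_fine_module_topology k A TA M T0"
    using fin by (simp add: is_fine_module_topology_def \<T>_def)
  then show ?thesis ..
qed

lemma fine_module_topology:
  assumes "st_ring k A TA" "Module.module A M"
  shows "is_fine_module_topology k A TA M (fine_module_topology k A TA M)"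
  unfolding fine_module_topology_def
  using fine_module_topology_exists[OF assms] is_fine_module_topology_unique
  by (metis theI)

definition local_ring :: "('a, 'x) ring_scheme \<Rightarrow> bool" where
  "local_ring R \<longleftrightarrow> cring R \<and> (\<exists>!m. maximalideal m R)"

definition artinian_ring :: "('a, 'x) ring_scheme \<Rightarrow> bool" where
  "artinian_ring R \<longleftrightarrow> cring R \<and>
     (\<forall>I :: nat \<Rightarrow> 'a set. (\<forall>n. ideal (I n) R \<and> I (Suc n) \<subseteq> I n) \<longrightarrow> (\<exists>N. \<forall>n\<ge>N. I n = I N))"

definition max_ideal :: "('a, 'x) ring_scheme \<Rightarrow> 'a set" where
  "max_ideal R = (THE m. maximalideal m R)"

definition residue_map :: "('k, 'a) module \<Rightarrow> 'a \<Rightarrow> 'a set" where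
  "residue_map A a = max_ideal A +>\<^bsub>A\<^esub> a"

text \<open>The residue field as a \<open>k\<close>-ring, with structure map \<open>k \<rightarrow> A \<rightarrow> K\<close>.\<close>

definition residue_field :: "('k, 'a) module \<Rightarrow> ('k, 'a set) module" where
  "residue_field A =
     restrict_scalars (\<lambda>c. residue_map A (structure_map A c)) (self_module (A Quot max_ideal A))"

definition residue_topology ::
    "('k, 'x) ring_scheme \<Rightarrow> ('k, 'a) module \<Rightarrow> 'a topology \<Rightarrow> 'a set topology" where
  "residue_topology k A TA =
     fine_module_topology k A TA (restrict_scalars (residue_map A) (self_module (residue_field A)))"

definition lifting ::
    "('k, 'x) ring_scheme \<Rightarrow> ('k, 'a) module \<Rightarrow> 'a topology \<Rightarrow> ('a set \<Rightarrow> 'a) \<Rightarrow> bool" where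
  "lifting k A TA \<sigma> \<longleftrightarrow>
     \<sigma> \<in> ring_hom (residue_field A) A \<and>
     (\<forall>c\<in>carrier k. \<forall>x\<in>carrier (residue_field A).
        \<sigma> (c \<odot>\<^bsub>residue_field A\<^esub> x) = c \<odot>\<^bsub>A\<^esub> \<sigma> x) \<and>
     continuous_map (residue_topology k A TA) TA \<sigma> \<and>
     (\<forall>x\<in>carrier (residue_field A). residue_map A (\<sigma> x) = x)"

definition precise_lifting ::
    "('k, 'x) ring_scheme \<Rightarrow> ('k, 'a) module \<Rightarrow> 'a topology \<Rightarrow> ('a set \<Rightarrow> 'a) \<Rightarrow> bool" where
  "precise_lifting k A TA \<sigma> \<longleftrightarrow>
     lifting k A TA \<sigma> \<and>
     TA = fine_module_topology k (residue_field A) (residue_topology k A TA)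
            (restrict_scalars \<sigma> (self_module A))"

definition precise_artinian_local_ring ::
    "('k, 'x) ring_scheme \<Rightarrow> ('k, 'a) module \<Rightarrow> 'a topology \<Rightarrow> bool" where
  "precise_artinian_local_ring k A TA \<longleftrightarrow>
     st_ring k A TA \<and> local_ring A \<and> artinian_ring A \<and> (\<exists>\<sigma>. precise_lifting k A TA \<sigma>)"

end

theory Submission
  imports Defs "HOL-Algebra.Ring_Divisibility"
begin

text \<open>
  Let \<open>\<tau>\<close> be a precise lifting and let \<open>TF\<close> be the fine \<open>(K, \<sigma>)\<close>-module topology on \<open>A\<close>, which refines
  \<open>TA\<close> since \<open>\<sigma>\<close> is continuous. A \<open>\<tau>\<close>-linear map \<open>f : (A, TA) \<rightarrow> (A, TF)\<close> is continuous as soon as all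
  maps \<open>x \<mapsto> \<tau> x \<cdot> f a\<close> from \<open>K\<close> to \<open>(A, TF)\<close> are, so for \<open>f = id\<close> it suffices that
  \<open>P b: x \<mapsto> \<tau> x \<cdot> b\<close> is continuous into \<open>TF\<close> for every \<open>b\<close>. If \<open>P\<close> holds on \<open>\<mm> b\<close>, then the \<open>\<tau>\<close>-linear map
  \<open>h a = (a - \<tau> (\<pi> a)) b\<close>, whose values lie in \<open>\<mm> b\<close>, is continuous into \<open>TF\<close>, and \<open>P b\<close> follows from
  \<open>\<tau> x \<cdot> b = \<sigma> x \<cdot> b + h (\<sigma> (- x))\<close>. This induction terminates because \<open>\<mm>\<close> is T-nilpotent: the chain of
  principal ideals generated by \<open>b\<close>, \<open>q\<^sub>1 b\<close>, \<open>q\<^sub>2 q\<^sub>1 b\<close>, \<dots> with \<open>q\<^sub>i \<in> \<mm>\<close> becomes stationary, which makes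
  these elements eventually zero. No basis of \<open>A\<close> over \<open>K\<close> is needed.
\<close>

section \<open>Rings as modules over themselves\<close>

lemma self_module_sel [simp]:
  "carrier (self_module R) = carrier R" "monoid.mult (self_module R) = monoid.mult R"
  "one (self_module R) = one R" "zero (self_module R) = zero R" "add (self_module R) = add R"
  "module.smult (self_module R) = monoid.mult R"
  by (simp_all add: self_module_def)

lemma self_module_cring:
  assumes "cring R"
  shows "cring (self_module R)"
proof -
  interpret cring R by fact
  show ?thesis
    by (intro cringI abelian_groupI comm_monoidI)
       (auto simp: a_ac m_ac r_distr intro: bexI[of _ "\<ominus>\<^bsub>R\<^esub> _"] l_neg)
qed

lemma restrict_scalars_cring:
  assumes "cring M"
  shows "cring (restrict_scalars f M)"
proof -
  interpret cring M by fact
  show ?thesis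
    by (intro cringI abelian_groupI comm_monoidI)
       (auto simp: a_ac m_ac r_distr intro: bexI[of _ "\<ominus>\<^bsub>M\<^esub> _"] l_neg)
qed

lemma module_self_module:
  assumes "cring R"
  shows "Module.module R (self_module R)"
proof -
  interpret cring R by fact
  interpret S: cring "self_module R" by (rule self_module_cring[OF assms])
  show ?thesis
    by (intro moduleI assms S.abelian_group_axioms) (auto simp: l_distr r_distr m_assoc)
qed

section \<open>Maximal ideals and induction over artinian local rings\<close>

lemma (in ring) proper_ideal_subset_maximalideal:
  assumes I: "ideal I R" "\<one> \<notin> I"
  shows "\<exists>m. maximalideal m R \<and> I \<subseteq> m"
proof -
  define S where "S = {J. ideal J R \<and> I \<subseteq> J \<and> \<one> \<notin> J}"
  have "\<exists>M\<in>S. \<forall>J\<in>S. M \<subseteq> J \<longrightarrow> J = M"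
  proof (rule subset_Zorn)
    fix C assume C: "subset.chain S C"
    show "\<exists>U\<in>S. \<forall>J\<in>C. J \<subseteq> U"
    proof (cases "C = {}")
      \<comment> \<open>The union of the empty chain is not an ideal, so \<open>I\<close> itself
        serves as the bound.\<close>
      case True
      then show ?thesis using I by (auto simp: S_def)
    next
      case False
      have CS: "C \<subseteq> S" using C by (auto simp: pred_on.chain_def)
      then have "subset.chain {J. ideal J R} C"
        using C by (auto simp: pred_on.chain_def S_def)
      then have "ideal (\<Union>C) R" using chain_Union_is_ideal[of C] False by simp
      then have "\<Union>C \<in> S" using CS False by (auto simp: S_def)
      then show ?thesis by blast
    qed
  qed
  then obtain M where M: "M \<in> S" "\<And>J. J \<in> S \<Longrightarrow> M \<subseteq> J \<Longrightarrow> J = M" by blast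
  have "maximalideal M R"
  proof (rule maximalidealI)
    fix J assume J: "ideal J R" "M \<subseteq> J" "J \<subseteq> carrier R"
    show "J = M \<or> J = carrier R"
    proof (cases "\<one> \<in> J")
      case True
      then show ?thesis using ideal.one_imp_carrier[OF J(1)] by simp
    next
      case False
      then show ?thesis using M J by (auto simp: S_def)
    qed
  qed (use M in \<open>auto simp: S_def\<close>)
  then show ?thesis using M by (auto simp: S_def)
qed

lemma maximalideal_max_ideal:
  assumes "local_ring A"
  shows "maximalideal (max_ideal A) A"
  using assms theI'[of "\<lambda>m. maximalideal m A"] unfolding local_ring_def max_ideal_def by blast

text \<open>The element \<open>\<one> \<ominus> r\<close> annihilates \<open>c\<close>. If
  \<open>c\<close> were nonzero, its annihilator would be a proper ideal and hence lie in the
  maximal ideal, which would then contain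
  \<open>(\<one> \<ominus> r) \<oplus> r = \<one>\<close>.\<close>

lemma local_ring_fixed_eq_zero:
  fixes A (structure)
  assumes A: "local_ring A" and r: "r \<in> max_ideal A" and c: "c \<in> carrier A" "r \<otimes> c = c"
  shows "c = \<zero>"
proof (rule ccontr)
  assume "c \<noteq> \<zero>"
  interpret cring A using A by (simp add: local_ring_def)
  interpret m: maximalideal "max_ideal A" A by (rule maximalideal_max_ideal[OF A])
  have r': "r \<in> carrier A" using r m.a_subset by blast
  define I where "I = {x \<in> carrier A. x \<otimes> c = \<zero>}"
  have "ideal I A"
  proof (rule idealI[OF ring_axioms])
    show "subgroup I (add_monoid A)"
      unfolding I_def using c(1)
      by unfold_locales (auto simp: l_distr l_minus simp flip: a_inv_def)
  next
    fix a x assume a: "a \<in> I" and x: "x \<in> carrier A"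
    then have "(x \<otimes> a) \<otimes> c = \<zero>" using c(1) by (simp add: I_def m_assoc)
    then show "x \<otimes> a \<in> I" "a \<otimes> x \<in> I" using a x by (auto simp: I_def m_comm)
  qed
  moreover have "\<one> \<notin> I" using \<open>c \<noteq> \<zero>\<close> c(1) by (simp add: I_def)
  ultimately obtain m where "maximalideal m A" "I \<subseteq> m"
    using proper_ideal_subset_maximalideal by blast
  moreover have "m = max_ideal A"
    using A \<open>maximalideal m A\<close> maximalideal_max_ideal[OF A] unfolding local_ring_def by blast
  moreover have "\<one> \<ominus> r \<in> I"
    using r' c by (simp add: I_def minus_eq l_distr l_minus r_neg)
  ultimately have "(\<one> \<ominus> r) \<oplus> r \<in> max_ideal A" using r m.a_closed by blast
  moreover have "(\<one> \<ominus> r) \<oplus> r = \<one>" using r' by (simp add: minus_eq a_assoc l_neg)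
  ultimately show False using m.one_imp_carrier m.I_notcarr by simp
qed

text \<open>A counterexample \<open>b\<close> would, by \<open>step\<close>, start an infinite
  sequence of counterexamples, each the multiple of the one before by an element of the maximal
  ideal. Their principal ideals become stationary, which forces some term to be zero, contrary to
  \<open>zero\<close>.\<close>

lemma artinian_local_ring_induct:
  fixes A (structure)
  assumes A: "local_ring A" "artinian_ring A" and b: "b \<in> carrier A" and zero: "P \<zero>"
    and step: "\<And>b. b \<in> carrier A \<Longrightarrow> (\<And>q. q \<in> max_ideal A \<Longrightarrow> P (q \<otimes> b)) \<Longrightarrow> P b"
  shows "P b"
proof (rule ccontr)
  assume nP: "\<not> P b"
  interpret cring A using A by (simp add: local_ring_def)
  interpret m: maximalideal "max_ideal A" A by (rule maximalideal_max_ideal[OF A(1)])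
  have "\<exists>c. c 0 = b \<and> (\<forall>n. (c n \<in> carrier A \<and> \<not> P (c n)) \<and> (\<exists>q\<in>max_ideal A. c (Suc n) = q \<otimes> c n))"
  proof -
    have "\<exists>c. \<forall>n. ((c n \<in> carrier A \<and> \<not> P (c n)) \<and> (n = 0 \<longrightarrow> c n = b)) \<and>
        (\<exists>q\<in>max_ideal A. c (Suc n) = q \<otimes> c n)"
    proof (rule dependent_nat_choice)
      fix x and n :: nat assume x: "(x \<in> carrier A \<and> \<not> P x) \<and> (n = 0 \<longrightarrow> x = b)"
      then obtain q where "q \<in> max_ideal A" "\<not> P (q \<otimes> x)" using step by blast
      then show "\<exists>y. ((y \<in> carrier A \<and> \<not> P y) \<and> (Suc n = 0 \<longrightarrow> y = b)) \<and> (\<exists>q\<in>max_ideal A. y = q \<otimes> x)"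
        using x m.a_subset by (intro exI[of _ "q \<otimes> x"]) auto
    qed (use b nP in auto)
    then show ?thesis by auto
  qed
  then obtain c where c: "\<And>n. c n \<in> carrier A" "\<And>n. \<not> P (c n)"
    and cS: "\<And>n. \<exists>q\<in>max_ideal A. c (Suc n) = q \<otimes> c n" by blast
  have chain: "ideal (PIdl (c n)) A \<and> PIdl (c (Suc n)) \<subseteq> PIdl (c n)" for n :: nat
  proof (intro conjI cgenideal_ideal[OF c(1)] cgenideal_minimal)
    show "c (Suc n) \<in> PIdl (c n)"
      using cS[of n] m.a_subset unfolding cgenideal_def by blast
  qed
  then obtain N where "\<forall>n\<ge>N. PIdl (c n) = PIdl (c N)"
    using A(2) chain unfolding artinian_ring_def by (elim conjE allE[of _ "\<lambda>n. PIdl (c n)"]) blast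
  \<comment> \<open>Equality at one step already suffices: it gives
    \<open>c N = r \<otimes> q \<otimes> c N\<close> with \<open>r \<otimes> q\<close> in the
    maximal ideal.\<close>
  then have "PIdl (c (Suc N)) = PIdl (c N)" by (meson le_SucI order_refl)
  then have "c N \<in> PIdl (c (Suc N))" using cgenideal_self[OF c(1)] by simp
  then obtain r where r: "r \<in> carrier A" "c N = r \<otimes> c (Suc N)"
    unfolding cgenideal_def by blast
  obtain q where q: "q \<in> max_ideal A" "c (Suc N) = q \<otimes> c N" using cS by blast
  have "(r \<otimes> q) \<otimes> c N = c N"
    using r q c(1)[of N] m.a_subset by (metis m_assoc subsetD)
  then have "c N = \<zero>"
    using local_ring_fixed_eq_zero[OF A(1) _ c(1)] m.I_l_closed[OF q(1) r(1)] by blast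
  then show False using zero c(2) by metis
qed

section \<open>Continuity of maps out of a fine module topology\<close>

text \<open>The initial topology on \<open>M\<close> for all maps \<open>x \<mapsto> f (a \<odot> x)\<close> with \<open>a \<in> K\<close>, rather than for \<open>f\<close> alone, is
  stable under multiplication by \<open>K\<close>, so it makes \<open>M\<close> an ST module and is coarser than the fine topology.\<close>

lemma continuous_map_fine_module_topology:
  assumes K: "algebra k K" "topspace TK = carrier K"
    and fine: "is_fine_module_topology k K TK M TM"
    and N: "linear_topology k N TN"
    and f_closed: "\<And>x. x \<in> carrier M \<Longrightarrow> f x \<in> carrier N"
    and f_add: "\<And>x y. x \<in> carrier M \<Longrightarrow> y \<in> carrier M \<Longrightarrow> f (x \<oplus>\<^bsub>M\<^esub> y) = f x \<oplus>\<^bsub>N\<^esub> f y"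
    and f_smult: "\<And>c x. c \<in> carrier k \<Longrightarrow> x \<in> carrier M \<Longrightarrow>
        f (structure_map K c \<odot>\<^bsub>M\<^esub> x) = c \<odot>\<^bsub>N\<^esub> f x"
    and f_cont: "\<And>m. m \<in> carrier M \<Longrightarrow> continuous_map TK TN (\<lambda>a. f (a \<odot>\<^bsub>M\<^esub> m))"
  shows "continuous_map TM TN f"
proof -
  interpret algebra k K by (fact K)
  have M: "Module.module K M" and topM: "topspace TM = carrier M"
    using fine by (auto simp: is_fine_module_topology_def st_module_def linear_topology_def)
  interpret M: Module.module K M by (fact M)
  have topN: "topspace TN = carrier N" and Nm: "Module.module k N"
    and N_add: "continuous_map (prod_topology TN TN) TN (\<lambda>(x, y). x \<oplus>\<^bsub>N\<^esub> y)"
    and N_smult: "continuous_map (prod_topology (discrete_topology (carrier k)) TN) TN (\<lambda>(c, x). c \<odot>\<^bsub>N\<^esub> x)"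
    and N_base: "\<And>U. openin TN U \<Longrightarrow> \<zero>\<^bsub>N\<^esub> \<in> U \<Longrightarrow> \<exists>V. submodule V k N \<and> openin TN V \<and> V \<subseteq> U"
    using N by (auto simp: linear_topology_def)
  interpret N: Module.module k N by (fact Nm)
  let ?M = "restrict_scalars (structure_map K) M"
  interpret Mk: Module.module k ?M
    by (rule module_restrict_scalars[OF R.cring_axioms structure_map_hom[OF K(1)] M])
  have sc: "structure_map K c \<in> carrier K" if "c \<in> carrier k" for c
    using that by (simp add: structure_map_def)
  define pre where "pre a U = {x \<in> carrier M. f (a \<odot>\<^bsub>M\<^esub> x) \<in> U}" for a U
  define S where "S = {pre a U | a U. a \<in> carrier K \<and> openin TN U}"
  define T where "T = topology_generated_by S"
  have one_K: "\<one>\<^bsub>K\<^esub> \<in> carrier K" by simp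
  \<comment> \<open>The scalar one exhibits all of \<open>M\<close> as a subbasic set, so the
    generated topology has the right underlying space.\<close>
  have "pre \<one>\<^bsub>K\<^esub> (carrier N) = carrier M"
    using f_closed by (auto simp: pre_def)
  then have "carrier M \<in> S"
    using topN openin_topspace[of TN] one_K unfolding S_def by (metis (mono_tags, lifting) mem_Collect_eq)
  then have US: "\<Union>S = carrier M" by (auto simp: S_def pre_def)
  then have topT: "topspace T = carrier M" by (simp add: T_def)
  have open_pre: "openin T (pre a U)" if "a \<in> carrier K" "openin TN U" for a U
    unfolding T_def using that by (intro topology_generated_by_Basis) (auto simp: S_def)
  have out: "continuous_map T TN (\<lambda>x. f (a \<odot>\<^bsub>M\<^esub> x))" if a: "a \<in> carrier K" for a
    using open_pre[OF a] f_closed a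
    by (auto simp: continuous_map_def topT topN pre_def)
  \<comment> \<open>The universal property of the initial topology: a map into \<open>T\<close> is
    tested by composing it with each \<open>x \<mapsto> f (a \<odot> x)\<close>.\<close>
  have into: "continuous_map X T g"
    if g: "\<And>x. x \<in> topspace X \<Longrightarrow> g x \<in> carrier M"
      and cont: "\<And>a. a \<in> carrier K \<Longrightarrow> continuous_map X TN (\<lambda>x. f (a \<odot>\<^bsub>M\<^esub> g x))"
    for X :: "'z topology" and g
    unfolding T_def
  proof (subst continuous_on_generated_topo_iff, intro conjI allI impI)
    fix W assume "W \<in> S"
    then obtain a U where aU: "a \<in> carrier K" "openin TN U" "W = pre a U" by (auto simp: S_def)
    have "g -` W \<inter> topspace X = {x \<in> topspace X. f (a \<odot>\<^bsub>M\<^esub> g x) \<in> U}"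
      using g aU(3) by (auto simp: pre_def)
    then show "openin X (g -` W \<inter> topspace X)"
      using openin_continuous_map_preimage[OF cont[OF aU(1)] aU(2)] by simp
  next
    show "g ` topspace X \<subseteq> \<Union>S" using g US by auto
  qed
  have "st_module k K TK M T"
    unfolding st_module_def linear_topology_def restrict_scalars_sel
  proof (intro conjI ballI allI impI)
    show "continuous_map (prod_topology T T) T (\<lambda>(x, y). x \<oplus>\<^bsub>M\<^esub> y)"
    proof (rule into)
      fix a assume a: "a \<in> carrier K"
      have "continuous_map (prod_topology T T) (prod_topology TN TN)
              (\<lambda>(x, y). (f (a \<odot>\<^bsub>M\<^esub> x), f (a \<odot>\<^bsub>M\<^esub> y)))"
        using out[OF a] by (subst continuous_map_prod_top) auto
      from continuous_map_compose[OF this N_add]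
      show "continuous_map (prod_topology T T) TN (\<lambda>z. f (a \<odot>\<^bsub>M\<^esub> (case z of (x, y) \<Rightarrow> x \<oplus>\<^bsub>M\<^esub> y)))"
        by (rule continuous_map_eq) (use a in \<open>auto simp: topT M.smult_r_distr f_add\<close>)
    qed (auto simp: topT)
    show "continuous_map (prod_topology (discrete_topology (carrier k)) T) T
        (\<lambda>(c, x). structure_map K c \<odot>\<^bsub>M\<^esub> x)"
    proof (rule into)
      fix a assume a: "a \<in> carrier K"
      \<comment> \<open>Scalars from \<open>k\<close> commute with \<open>a\<close> because
        \<open>K\<close> is commutative, so each test map inherits the \<open>k\<close>-linearity of
        \<open>f\<close>.\<close>
      have eq: "f (a \<odot>\<^bsub>M\<^esub> (structure_map K c \<odot>\<^bsub>M\<^esub> x)) = c \<odot>\<^bsub>N\<^esub> f (a \<odot>\<^bsub>M\<^esub> x)"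
        if "c \<in> carrier k" "x \<in> carrier M" for c x
        using a that sc[OF that(1)] f_smult[OF that(1), of "a \<odot>\<^bsub>M\<^esub> x"]
        by (simp add: m_comm flip: M.smult_assoc1)
      have "continuous_map (prod_topology (discrete_topology (carrier k)) T)
              (prod_topology (discrete_topology (carrier k)) TN) (\<lambda>(c, x). (c, f (a \<odot>\<^bsub>M\<^esub> x)))"
        using out[OF a] by (subst continuous_map_prod_top) auto
      from continuous_map_compose[OF this N_smult]
      show "continuous_map (prod_topology (discrete_topology (carrier k)) T) TN
          (\<lambda>z. f (a \<odot>\<^bsub>M\<^esub> (case z of (c, x) \<Rightarrow> structure_map K c \<odot>\<^bsub>M\<^esub> x)))"
        by (rule continuous_map_eq) (auto simp: topT eq)
    qed (auto simp: topT sc)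
    show "continuous_map T T (\<lambda>x. b \<odot>\<^bsub>M\<^esub> x)" if b: "b \<in> carrier K" for b
    proof (rule into)
      fix a assume a: "a \<in> carrier K"
      \<comment> \<open>This is where the test maps for all scalars are used: testing
        \<open>b \<odot> x\<close> at \<open>a\<close> amounts to testing \<open>x\<close> at
        \<open>a \<otimes> b\<close>.\<close>
      from out[of "a \<otimes>\<^bsub>K\<^esub> b"] show "continuous_map T TN (\<lambda>x. f (a \<odot>\<^bsub>M\<^esub> (b \<odot>\<^bsub>M\<^esub> x)))"
        by (rule continuous_map_eq) (use a b in \<open>auto simp: topT M.smult_assoc1\<close>)
    qed (use b topT in auto)
    show "continuous_map TK T (\<lambda>b. b \<odot>\<^bsub>M\<^esub> x)" if x: "x \<in> carrier M" for x
    proof (rule into)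
      fix a assume a: "a \<in> carrier K"
      \<comment> \<open>By commutativity
        \<open>a \<odot> (b \<odot> x) = b \<odot> (a \<odot> x)\<close>, so the hypothesis applies
        to the element \<open>a \<odot> x\<close>.\<close>
      from f_cont[of "a \<odot>\<^bsub>M\<^esub> x"] show "continuous_map TK TN (\<lambda>b. f (a \<odot>\<^bsub>M\<^esub> (b \<odot>\<^bsub>M\<^esub> x)))"
        by (rule continuous_map_eq) (use a x K(2) in \<open>auto simp: m_comm simp flip: M.smult_assoc1\<close>)
    qed (use x K(2) in auto)
    fix U assume U: "openin T U \<and> \<zero>\<^bsub>M\<^esub> \<in> U"
    then have "generate_topology_on S U" "\<zero>\<^bsub>M\<^esub> \<in> U"
      using openin_topology_generated_by unfolding T_def by auto
    then show "\<exists>V. submodule V k ?M \<and> openin T V \<and> V \<subseteq> U"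
    proof (induct rule: generate_topology_on.induct)
      case (Int a b)
      then obtain V W where V: "submodule V k ?M" "openin T V" "V \<subseteq> a"
        and W: "submodule W k ?M" "openin T W" "W \<subseteq> b" by auto
      have "submodule (V \<inter> W) k ?M"
      proof (rule Mk.submoduleI)
        show "V \<inter> W \<subseteq> carrier ?M" using Mk.submoduleE(1)[OF V(1)] by blast
        show "\<zero>\<^bsub>?M\<^esub> \<in> V \<inter> W"
          using subgroup.one_closed[OF submodule.axioms(1)[OF V(1)]]
            subgroup.one_closed[OF submodule.axioms(1)[OF W(1)]] by simp
      qed (simp_all add: Mk.submoduleE[OF V(1), simplified] Mk.submoduleE[OF W(1), simplified])
      moreover have "openin T (V \<inter> W)" "V \<inter> W \<subseteq> a \<inter> b" using V W by auto
      ultimately show ?case by blast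
    next
      case (Basis W)
      then obtain a U where aU: "a \<in> carrier K" "openin TN U" "W = pre a U" by (auto simp: S_def)
      have f0: "f \<zero>\<^bsub>M\<^esub> = \<zero>\<^bsub>N\<^esub>"
        using f_add[of "\<zero>\<^bsub>M\<^esub>" "\<zero>\<^bsub>M\<^esub>"] f_closed[of "\<zero>\<^bsub>M\<^esub>"] by simp
      have f_neg: "f (\<ominus>\<^bsub>M\<^esub> x) = \<ominus>\<^bsub>N\<^esub> f x" if "x \<in> carrier M" for x
        using that f_add[of "\<ominus>\<^bsub>M\<^esub> x" x] f0 f_closed by (simp add: M.M.l_neg N.M.minus_equality)
      have "\<zero>\<^bsub>N\<^esub> \<in> U" using Basis(2) aU f0 by (simp add: pre_def)
      \<comment> \<open>A submodule neighborhood in \<open>N\<close> pulls back along the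
        \<open>k\<close>-linear map \<open>x \<mapsto> f (a \<odot> x)\<close> to a submodule
        neighborhood in \<open>M\<close>; the facts up to \<open>eq\<close> supply this
        linearity.\<close>
      then obtain V where V: "submodule V k N" "openin TN V" "V \<subseteq> U" using N_base[OF aU(2)] by blast
      have zV: "\<zero>\<^bsub>N\<^esub> \<in> V" using subgroup.one_closed[OF submodule.axioms(1)[OF V(1)]] by simp
      note VE = N.submoduleE[OF V(1)]
      have neg: "\<ominus>\<^bsub>?M\<^esub> x = \<ominus>\<^bsub>M\<^esub> x" for x by (simp add: a_inv_def m_inv_def)
      have eq: "f (a \<odot>\<^bsub>M\<^esub> (structure_map K c \<odot>\<^bsub>M\<^esub> x)) = c \<odot>\<^bsub>N\<^esub> f (a \<odot>\<^bsub>M\<^esub> x)"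
        if "c \<in> carrier k" "x \<in> carrier M" for c x
        using aU(1) that sc[OF that(1)] f_smult[OF that(1), of "a \<odot>\<^bsub>M\<^esub> x"]
        by (simp add: m_comm flip: M.smult_assoc1)
      have "submodule (pre a V) k ?M"
        by (rule Mk.submoduleI)
           (use aU(1) zV f0 VE in \<open>auto simp: pre_def neg f_neg f_add M.smult_r_distr M.smult_r_minus eq sc\<close>)
      moreover have "pre a V \<subseteq> W" using V(3) aU(3) by (auto simp: pre_def)
      ultimately show ?case using open_pre[OF aU(1) V(2)] by blast
    next
      case (UN L)
      then obtain U where "U \<in> L" "\<zero>\<^bsub>M\<^esub> \<in> U" by auto
      from UN(2)[OF this] obtain V where "submodule V k ?M" "openin T V" "V \<subseteq> U" by auto
      then show ?case using \<open>U \<in> L\<close> by (intro exI[of _ V]) auto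
    qed simp
  qed (use Mk.module_axioms topT M in auto)
  then have finer: "openin TM U" if "openin T U" for U
    using fine that by (auto simp: is_fine_module_topology_def)
  \<comment> \<open>The map \<open>f\<close> itself is the test map for the scalar one.\<close>
  have "continuous_map T TN (\<lambda>x. f (\<one>\<^bsub>K\<^esub> \<odot>\<^bsub>M\<^esub> x))" by (rule out) simp
  then have "continuous_map T TN f" by (rule continuous_map_eq) (simp add: topT)
  then show ?thesis using finer by (auto simp: continuous_map_def topT topM)
qed

section \<open>The residue field as an ST ring\<close>

lemma residue_field_sel:
  "carrier (residue_field A) = carrier (A Quot max_ideal A)"
  "monoid.mult (residue_field A) = monoid.mult (A Quot max_ideal A)"
  "one (residue_field A) = one (A Quot max_ideal A)"
  "zero (residue_field A) = zero (A Quot max_ideal A)"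
  "add (residue_field A) = add (A Quot max_ideal A)"
  "module.smult (residue_field A) =
     (\<lambda>c x. residue_map A (structure_map A c) \<otimes>\<^bsub>A Quot max_ideal A\<^esub> x)"
  by (simp_all add: residue_field_def)

lemma residue_map_hom:
  assumes "local_ring A"
  shows "residue_map A \<in> ring_hom A (residue_field A)"
proof -
  interpret maximalideal "max_ideal A" A by (rule maximalideal_max_ideal[OF assms])
  show ?thesis
    using rcos_ring_hom by (simp add: ring_hom_def residue_map_def[abs_def] residue_field_sel)
qed

lemma residue_map_surj:
  assumes "x \<in> carrier (residue_field A)"
  obtains a where "a \<in> carrier A" "x = residue_map A a"
  using assms by (auto simp: residue_field_sel FactRing_def A_RCOSETS_def' residue_map_def)

lemma residue_map_eq_zero_iff:
  assumes "local_ring A" "a \<in> carrier A"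
  shows "residue_map A a = \<zero>\<^bsub>residue_field A\<^esub> \<longleftrightarrow> a \<in> max_ideal A"
proof -
  interpret maximalideal "max_ideal A" A by (rule maximalideal_max_ideal[OF assms(1)])
  show ?thesis
    using assms(2) rcos_const_imp_mem a_rcos_const
    by (auto simp: residue_map_def residue_field_sel FactRing_def)
qed

lemma cring_residue_field:
  assumes "local_ring A"
  shows "cring (residue_field A)"
proof -
  interpret maximalideal "max_ideal A" A by (rule maximalideal_max_ideal[OF assms])
  have "cring A" using assms by (simp add: local_ring_def)
  then show ?thesis
    unfolding residue_field_def
    by (intro restrict_scalars_cring self_module_cring quotient_is_cring)
qed

lemma structure_map_residue_field:
  assumes "local_ring A" "algebra k A" "c \<in> carrier k"
  shows "structure_map (residue_field A) c = residue_map A (structure_map A c)"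
proof -
  interpret K: cring "residue_field A" by (rule cring_residue_field[OF assms(1)])
  have "structure_map A c \<in> carrier A"
    using ring_hom_closed[OF structure_map_hom[OF assms(2)] assms(3)] .
  then have "residue_map A (structure_map A c) \<in> carrier (residue_field A)"
    using ring_hom_closed[OF residue_map_hom[OF assms(1)]] by blast
  then show ?thesis
    using K.r_one by (simp add: structure_map_def[of "residue_field A"] residue_field_sel)
qed

lemma residue_field_algebra:
  assumes A: "local_ring A" "algebra k A"
  shows "algebra k (residue_field A)"
proof -
  interpret K: cring "residue_field A" by (rule cring_residue_field[OF A(1)])
  interpret algebra k A by (fact A)
  have hom: "residue_map A \<circ> structure_map A \<in> ring_hom k (residue_field A)"
    using ring_hom_trans[OF structure_map_hom[OF A(2)] residue_map_hom[OF A(1)]] .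
  note h = ring_hom_closed[OF hom] ring_hom_mult[OF hom] ring_hom_add[OF hom] ring_hom_one[OF hom]
  have sm: "c \<odot>\<^bsub>residue_field A\<^esub> x = (residue_map A \<circ> structure_map A) c \<otimes>\<^bsub>residue_field A\<^esub> x" for c x
    by (simp add: residue_field_sel)
  show ?thesis
    by (rule algebraI)
       (simp_all only: sm h R.cring_axioms K.cring_axioms K.m_closed K.l_distr K.r_distr K.m_assoc K.l_one)
qed

text \<open>The topology of \<open>K\<close> is defined through its \<open>A\<close>-module
  structure, which yields continuity of multiplication by images of elements of \<open>A\<close>.
  These are all elements of \<open>K\<close>, since \<open>residue_map A\<close> is
  surjective.\<close>

lemma residue_field_st_ring:
  assumes A: "local_ring A" "st_ring k A TA"
  shows "st_ring k (residue_field A) (residue_topology k A TA)"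
proof -
  let ?K = "residue_field A" and ?T = "residue_topology k A TA"
  let ?M = "restrict_scalars (residue_map A) (self_module ?K)"
  interpret K: cring ?K by (rule cring_residue_field[OF A(1)])
  have alg: "algebra k A" using A(2) by (simp add: st_ring_def)
  have "cring A" using A by (simp add: local_ring_def)
  have "is_fine_module_topology k A TA ?M ?T"
    unfolding residue_topology_def
    by (rule fine_module_topology[OF A(2) module_restrict_scalars[OF \<open>cring A\<close> residue_map_hom[OF A(1)]
          module_self_module[OF K.cring_axioms]]])
  then have "st_module k A TA ?M ?T" by (simp add: is_fine_module_topology_def)
  \<comment> \<open>Equality of records: \<open>residue_field\<close> already takes its scalars
    along \<open>k \<rightarrow> A \<rightarrow> K\<close>.\<close>
  moreover have "restrict_scalars (structure_map A) ?M = ?K"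
    by (simp add: residue_field_def restrict_scalars_def self_module_def)
  ultimately have lin: "linear_topology k ?K ?T"
    and cont: "\<And>a. a \<in> carrier A \<Longrightarrow> continuous_map ?T ?T (\<lambda>x. residue_map A a \<otimes>\<^bsub>?K\<^esub> x)"
    by (auto simp: st_module_def)
  show ?thesis
    unfolding st_ring_def using lin residue_field_algebra[OF A(1) alg] cont residue_map_surj by metis
qed

section \<open>Module structures on \<open>A\<close> induced by liftings\<close>

text \<open>Follows from \<open>k\<close>-linearity applied to one. As the right-hand side does not
  involve \<open>\<sigma>\<close>, all liftings induce the same \<open>k\<close>-module structure on
  \<open>A\<close>, so that linear topologies for different liftings are comparable.\<close>

lemma lifting_structure_map:
  assumes A: "local_ring A" "algebra k A" and \<sigma>: "lifting k A TA \<sigma>" and c: "c \<in> carrier k"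
  shows "\<sigma> (structure_map (residue_field A) c) = structure_map A c"
proof -
  interpret K: cring "residue_field A" by (rule cring_residue_field[OF A(1)])
  show ?thesis
    using \<sigma> c ring_hom_one[of \<sigma> "residue_field A" A]
    by (auto simp: lifting_def structure_map_def)
qed

lemma lifting_module:
  assumes A: "local_ring A" and \<sigma>: "lifting k A TA \<sigma>"
  shows "Module.module (residue_field A) (restrict_scalars \<sigma> (self_module A))"
  using A \<sigma> cring_residue_field[OF A]
  by (intro module_restrict_scalars[of _ _ A] module_self_module) (auto simp: local_ring_def lifting_def)

text \<open>This makes \<open>TA\<close> a competitor in the definition of the fine topology along
  \<open>\<sigma>\<close>, so that the latter refines \<open>TA\<close>. Scalars act as elements of
  the ST ring \<open>A\<close>, and \<open>a \<mapsto> \<sigma> a \<otimes> x\<close> is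
  \<open>\<sigma>\<close> followed by a multiplication of \<open>A\<close>.\<close>

lemma lifting_st_module:
  assumes A: "local_ring A" "st_ring k A TA" and \<sigma>: "lifting k A TA \<sigma>"
  shows "st_module k (residue_field A) (residue_topology k A TA) (restrict_scalars \<sigma> (self_module A)) TA"
proof -
  let ?K = "residue_field A" and ?TK = "residue_topology k A TA"
  let ?M = "restrict_scalars \<sigma> (self_module A)"
  let ?N = "restrict_scalars (structure_map ?K) ?M"
  have alg: "algebra k A" and lin: "linear_topology k A TA"
    and mult: "\<And>a. a \<in> carrier A \<Longrightarrow> continuous_map TA TA (\<lambda>b. a \<otimes>\<^bsub>A\<^esub> b)"
    using A(2) by (auto simp: st_ring_def)
  have \<sigma>_closed: "\<sigma> x \<in> carrier A" if "x \<in> carrier ?K" for x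
    using \<sigma> that ring_hom_closed unfolding lifting_def by metis
  have \<sigma>_cont: "continuous_map ?TK TA \<sigma>" using \<sigma> by (simp add: lifting_def)
  interpret algebra k A by (fact alg)
  have N: "Module.module k ?N"
    by (rule module_restrict_scalars[OF R.cring_axioms structure_map_hom[OF residue_field_algebra[OF A(1) alg]]
          lifting_module[OF A(1) \<sigma>]])
  interpret N: Module.module k ?N by (fact N)
  have smult: "c \<odot>\<^bsub>?N\<^esub> x = c \<odot>\<^bsub>A\<^esub> x" if "c \<in> carrier k" "x \<in> carrier A" for c x
  proof -
    have "c \<odot>\<^bsub>?N\<^esub> x = structure_map A c \<otimes>\<^bsub>A\<^esub> x"
      using that by (simp add: lifting_structure_map[OF A(1) alg \<sigma>])
    then show ?thesis using that by (simp add: structure_map_def smult_assoc2)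
  qed
  \<comment> \<open>Since the two scalar actions of \<open>k\<close> agree, the submodule
    neighborhoods in \<open>A\<close> carry over to \<open>?N\<close>.\<close>
  have sub: "submodule V k ?N" if V: "submodule V k A" for V
  proof (rule N.submoduleI)
    have neg: "\<ominus>\<^bsub>?N\<^esub> x = \<ominus>\<^bsub>A\<^esub> x" for x by (simp add: a_inv_def m_inv_def)
    show "\<zero>\<^bsub>?N\<^esub> \<in> V" using subgroup.one_closed[OF submodule.axioms(1)[OF V]] by simp
    show "\<ominus>\<^bsub>?N\<^esub> x \<in> V" if "x \<in> V" for x using submoduleE(3)[OF V that] neg by simp
    show "c \<odot>\<^bsub>?N\<^esub> x \<in> V" if "c \<in> carrier k" "x \<in> V" for c x
      using submoduleE(1,4)[OF V] that smult by (metis subsetD)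
  qed (use submoduleE[OF V] in auto)
  have topA: "topspace TA = carrier A" using lin by (simp add: linear_topology_def)
  show ?thesis
    unfolding st_module_def
  proof (intro conjI ballI)
    have "continuous_map (prod_topology (discrete_topology (carrier k)) TA) TA (\<lambda>(c, x). c \<odot>\<^bsub>?N\<^esub> x)"
    proof (rule continuous_map_eq)
      show "continuous_map (prod_topology (discrete_topology (carrier k)) TA) TA (\<lambda>(c, x). c \<odot>\<^bsub>A\<^esub> x)"
        using lin by (simp add: linear_topology_def)
    qed (use smult topA in auto)
    moreover have "\<exists>V. submodule V k ?N \<and> openin TA V \<and> V \<subseteq> U" if "openin TA U" "\<zero>\<^bsub>A\<^esub> \<in> U" for U
    proof -
      obtain V where "submodule V k A" "openin TA V" "V \<subseteq> U"
        using lin \<open>openin TA U\<close> \<open>\<zero>\<^bsub>A\<^esub> \<in> U\<close> unfolding linear_topology_def by metis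
      then show ?thesis using sub by blast
    qed
    ultimately show "linear_topology k ?N TA"
      using lin N unfolding linear_topology_def by simp
    show "continuous_map ?TK TA (\<lambda>a. a \<odot>\<^bsub>?M\<^esub> x)" if x: "x \<in> carrier ?M" for x
    proof (rule continuous_map_eq)
      show "continuous_map ?TK TA (\<lambda>a. x \<otimes>\<^bsub>A\<^esub> \<sigma> a)"
        using continuous_map_compose[OF \<sigma>_cont mult] x by (simp add: o_def)
      show "x \<otimes>\<^bsub>A\<^esub> \<sigma> a = a \<odot>\<^bsub>?M\<^esub> x" if "a \<in> topspace ?TK" for a
      proof -
        have "\<sigma> a \<in> carrier A" using that \<sigma>_cont topA by (auto simp: continuous_map_def)
        then show ?thesis using x by (simp add: m_comm)
      qed
    qed
  qed (use lifting_module[OF A(1) \<sigma>] mult \<sigma>_closed in auto)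
qed

section \<open>Comparison of the topologies of two liftings\<close>

theorem corollary0p14:
  fixes k :: "('k, 'x) ring_scheme"
    and A :: "('k, 'a) module"
    and TA :: "'a topology"
    and \<sigma> :: "'a set \<Rightarrow> 'a"
  assumes "cring k" and "\<one>\<^bsub>k\<^esub> \<noteq> \<zero>\<^bsub>k\<^esub>"
    and "precise_artinian_local_ring k A TA"
    and "lifting k A TA \<sigma>"
  shows "precise_lifting k A TA \<sigma>"
proof -
  note \<sigma> = assms(4)
  let ?K = "residue_field A" and ?TK = "residue_topology k A TA"
  let ?\<pi> = "residue_map A"
  let ?M = "\<lambda>\<tau>. restrict_scalars \<tau> (self_module A)"
  let ?N = "restrict_scalars (structure_map ?K) (?M \<sigma>)"
  define TF where "TF = fine_module_topology k ?K ?TK (?M \<sigma>)"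
  obtain \<tau> where st: "st_ring k A TA" and loc: "local_ring A" and art: "artinian_ring A"
    and "precise_lifting k A TA \<tau>"
    using assms(3) by (auto simp: precise_artinian_local_ring_def)
  then have \<tau>: "lifting k A TA \<tau>" and TA: "TA = fine_module_topology k ?K ?TK (?M \<tau>)"
    by (auto simp: precise_lifting_def)
  have alg: "algebra k A" and topA: "topspace TA = carrier A"
    using st by (auto simp: st_ring_def linear_topology_def)
  have stK: "st_ring k ?K ?TK" by (rule residue_field_st_ring[OF loc st])
  have algK: "algebra k ?K" and topK: "topspace ?TK = carrier ?K"
    using stK by (auto simp: st_ring_def linear_topology_def)
  have fine_\<tau>: "is_fine_module_topology k ?K ?TK (?M \<tau>) TA"
    by (subst TA) (rule fine_module_topology[OF stK lifting_module[OF loc \<tau>]])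
  have fine_\<sigma>: "is_fine_module_topology k ?K ?TK (?M \<sigma>) TF"
    unfolding TF_def by (rule fine_module_topology[OF stK lifting_module[OF loc \<sigma>]])
  interpret A: cring A using loc by (simp add: local_ring_def)
  interpret m: maximalideal "max_ideal A" A by (rule maximalideal_max_ideal[OF loc])
  interpret K: cring ?K by (rule cring_residue_field[OF loc])
  interpret \<pi>: ring_hom_cring A ?K ?\<pi>
    by (intro ring_hom_cring.intro ring_hom_cring_axioms.intro residue_map_hom loc A.is_cring K.is_cring)
  interpret \<sigma>: ring_hom_cring ?K A \<sigma>
    by (intro ring_hom_cring.intro ring_hom_cring_axioms.intro A.is_cring K.is_cring) (use \<sigma> in \<open>simp add: lifting_def\<close>)
  interpret \<tau>: ring_hom_cring ?K A \<tau>
    by (intro ring_hom_cring.intro ring_hom_cring_axioms.intro A.is_cring K.is_cring) (use \<tau> in \<open>simp add: lifting_def\<close>)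
  have \<pi>_sect: "?\<pi> (\<sigma> x) = x" "?\<pi> (\<tau> x) = x" if "x \<in> carrier ?K" for x
    using \<sigma> \<tau> that by (auto simp: lifting_def)
  have \<sigma>_cont: "continuous_map ?TK TA \<sigma>" using \<sigma> by (simp add: lifting_def)
  have neg_cont: "continuous_map ?TK ?TK (\<lambda>x. \<ominus>\<^bsub>?K\<^esub> x)"
  proof (rule continuous_map_eq)
    \<comment> \<open>Negation is multiplication by the element \<open>\<ominus> \<one>\<close> of
      the ST ring \<open>K\<close>.\<close>
    show "continuous_map ?TK ?TK (\<lambda>x. (\<ominus>\<^bsub>?K\<^esub> \<one>\<^bsub>?K\<^esub>) \<otimes>\<^bsub>?K\<^esub> x)"
      using stK by (simp add: st_ring_def)
  qed (simp add: topK K.l_minus)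
  have stF: "linear_topology k ?N TF" and topF: "topspace TF = carrier A"
    and F_smult: "\<And>b. b \<in> carrier A \<Longrightarrow> continuous_map ?TK TF (\<lambda>x. \<sigma> x \<otimes>\<^bsub>A\<^esub> b)"
    and F_add: "continuous_map (prod_topology TF TF) TF (\<lambda>(x, y). x \<oplus>\<^bsub>A\<^esub> y)"
    using fine_\<sigma> by (auto simp: is_fine_module_topology_def st_module_def linear_topology_def)
  \<comment> \<open>The continuity criterion with \<open>TA\<close> as the fine topology along
    \<open>\<tau>\<close>. The target carries its \<open>k\<close>-structure through
    \<open>\<sigma>\<close>, and \<open>lifting_structure_map\<close> for both liftings reconciles
    it with that of the source.\<close>
  have \<tau>_linear_continuous: "continuous_map TA TF f"
    if f: "\<And>a. a \<in> carrier A \<Longrightarrow> f a \<in> carrier A"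
      "\<And>a b. a \<in> carrier A \<Longrightarrow> b \<in> carrier A \<Longrightarrow> f (a \<oplus>\<^bsub>A\<^esub> b) = f a \<oplus>\<^bsub>A\<^esub> f b"
      "\<And>x a. x \<in> carrier ?K \<Longrightarrow> a \<in> carrier A \<Longrightarrow> f (\<tau> x \<otimes>\<^bsub>A\<^esub> a) = \<tau> x \<otimes>\<^bsub>A\<^esub> f a"
      and cont: "\<And>a. a \<in> carrier A \<Longrightarrow> continuous_map ?TK TF (\<lambda>x. \<tau> x \<otimes>\<^bsub>A\<^esub> f a)" for f
  proof (rule continuous_map_fine_module_topology[OF algK topK fine_\<tau> stF])
    show "continuous_map ?TK TF (\<lambda>x. f (x \<odot>\<^bsub>?M \<tau>\<^esub> a))" if "a \<in> carrier (?M \<tau>)" for a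
      using cont[of a] by (rule continuous_map_eq) (use that f(3) topK in auto)
    fix c a assume c: "c \<in> carrier k" and a: "a \<in> carrier (?M \<tau>)"
    have "structure_map ?K c \<in> carrier ?K"
      using ring_hom_closed[OF structure_map_hom[OF algK] c] .
    then show "f (structure_map ?K c \<odot>\<^bsub>?M \<tau>\<^esub> a) = c \<odot>\<^bsub>?N\<^esub> f a"
      using f(3)[of "structure_map ?K c" a] a
      by (simp add: lifting_structure_map[OF loc alg \<tau> c] lifting_structure_map[OF loc alg \<sigma> c])
  qed (use f in auto)
  have P: "continuous_map ?TK TF (\<lambda>x. \<tau> x \<otimes>\<^bsub>A\<^esub> b)" if "b \<in> carrier A" for b
  proof (rule artinian_local_ring_induct[OF loc art that,
        where P = "\<lambda>b. continuous_map ?TK TF (\<lambda>x. \<tau> x \<otimes>\<^bsub>A\<^esub> b)"])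
    show "continuous_map ?TK TF (\<lambda>x. \<tau> x \<otimes>\<^bsub>A\<^esub> \<zero>\<^bsub>A\<^esub>)"
      by (rule continuous_map_eq[of _ _ "\<lambda>x. \<zero>\<^bsub>A\<^esub>"]) (auto simp: topF topK)
  next
    fix b assume b: "b \<in> carrier A"
      and IH: "\<And>q. q \<in> max_ideal A \<Longrightarrow> continuous_map ?TK TF (\<lambda>x. \<tau> x \<otimes>\<^bsub>A\<^esub> (q \<otimes>\<^bsub>A\<^esub> b))"
    \<comment> \<open>The \<open>\<tau>\<close>-linear projection of \<open>A\<close> onto the
      maximal ideal along the coefficient field \<open>\<tau> K\<close>; it lands there because
      \<open>\<pi> \<circ> \<tau>\<close> is the identity.\<close>
    define q where "q a = a \<ominus>\<^bsub>A\<^esub> \<tau> (?\<pi> a)" for a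
    have q_mem: "q a \<in> max_ideal A" if a: "a \<in> carrier A" for a
    proof -
      have "?\<pi> (q a) = \<zero>\<^bsub>?K\<^esub>"
        using a by (simp add: q_def A.minus_eq \<pi>_sect K.r_neg)
      then show ?thesis
        using residue_map_eq_zero_iff[OF loc, of "q a"] a by (simp add: q_def)
    qed
    have q_closed: "q a \<in> carrier A" if "a \<in> carrier A" for a using that by (simp add: q_def)
    \<comment> \<open>The criterion asks for continuity of
      \<open>x \<mapsto> \<tau> x \<otimes> (q a \<otimes> b)\<close>, which is the induction
      hypothesis for the element \<open>q a\<close> of the maximal ideal.\<close>
    have "continuous_map TA TF (\<lambda>a. q a \<otimes>\<^bsub>A\<^esub> b)"
    proof (rule \<tau>_linear_continuous)
      show "continuous_map ?TK TF (\<lambda>x. \<tau> x \<otimes>\<^bsub>A\<^esub> (q a \<otimes>\<^bsub>A\<^esub> b))" if "a \<in> carrier A" for a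
        using IH[OF q_mem[OF that]] .
      show "q (a \<oplus>\<^bsub>A\<^esub> c) \<otimes>\<^bsub>A\<^esub> b = q a \<otimes>\<^bsub>A\<^esub> b \<oplus>\<^bsub>A\<^esub> q c \<otimes>\<^bsub>A\<^esub> b"
        if "a \<in> carrier A" "c \<in> carrier A" for a c
      proof -
        have "q (a \<oplus>\<^bsub>A\<^esub> c) = q a \<oplus>\<^bsub>A\<^esub> q c"
          using that by (simp add: q_def A.minus_eq A.minus_add A.a_ac)
        then show ?thesis using that b q_closed by (simp add: A.l_distr)
      qed
      show "q (\<tau> x \<otimes>\<^bsub>A\<^esub> a) \<otimes>\<^bsub>A\<^esub> b = \<tau> x \<otimes>\<^bsub>A\<^esub> (q a \<otimes>\<^bsub>A\<^esub> b)"
        if "x \<in> carrier ?K" "a \<in> carrier A" for x a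
      proof -
        have "q (\<tau> x \<otimes>\<^bsub>A\<^esub> a) = \<tau> x \<otimes>\<^bsub>A\<^esub> q a"
          using that by (simp add: q_def A.minus_eq \<pi>_sect A.r_distr A.r_minus)
        then show ?thesis using that b q_closed by (simp add: A.m_assoc)
      qed
    qed (use b q_closed in auto)
    then have "continuous_map ?TK TF (\<lambda>x. q (\<sigma> x) \<otimes>\<^bsub>A\<^esub> b)"
      using continuous_map_compose[OF \<sigma>_cont] by (simp add: o_def)
    \<comment> \<open>The sign is chosen so that \<open>q (\<sigma> (\<ominus> x)) = \<ominus>
      \<sigma> x \<oplus> \<tau> x\<close>; adding \<open>\<sigma> x\<close> then recovers
      \<open>\<tau> x\<close> by continuity of addition alone.\<close>
    then have q\<sigma>: "continuous_map ?TK TF (\<lambda>x. q (\<sigma> (\<ominus>\<^bsub>?K\<^esub> x)) \<otimes>\<^bsub>A\<^esub> b)"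
      using continuous_map_compose[OF neg_cont] by (simp add: o_def)
    have "continuous_map ?TK (prod_topology TF TF) (\<lambda>x. (\<sigma> x \<otimes>\<^bsub>A\<^esub> b, q (\<sigma> (\<ominus>\<^bsub>?K\<^esub> x)) \<otimes>\<^bsub>A\<^esub> b))"
      using F_smult[OF b] q\<sigma> by (rule continuous_map_pairedI)
    from continuous_map_compose[OF this F_add]
    show "continuous_map ?TK TF (\<lambda>x. \<tau> x \<otimes>\<^bsub>A\<^esub> b)"
    proof (rule continuous_map_eq)
      fix x assume "x \<in> topspace ?TK"
      then have x: "x \<in> carrier ?K" using topK by simp
      have "q (\<sigma> (\<ominus>\<^bsub>?K\<^esub> x)) = \<ominus>\<^bsub>A\<^esub> \<sigma> x \<oplus>\<^bsub>A\<^esub> \<tau> x"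
        using x by (simp add: q_def \<pi>_sect A.minus_eq)
      then have "\<sigma> x \<oplus>\<^bsub>A\<^esub> q (\<sigma> (\<ominus>\<^bsub>?K\<^esub> x)) = \<tau> x"
        using x by (simp add: A.r_neg flip: A.a_assoc)
      then show "((\<lambda>(x, y). x \<oplus>\<^bsub>A\<^esub> y) \<circ> (\<lambda>x. (\<sigma> x \<otimes>\<^bsub>A\<^esub> b, q (\<sigma> (\<ominus>\<^bsub>?K\<^esub> x)) \<otimes>\<^bsub>A\<^esub> b))) x = \<tau> x \<otimes>\<^bsub>A\<^esub> b"
        using x b q_closed by (simp flip: A.l_distr)
    qed
  qed
  \<comment> \<open>For the identity map the continuity condition is exactly \<open>P\<close>; hence
    \<open>TA\<close> refines \<open>TF\<close>.\<close>
  have "continuous_map TA TF (\<lambda>a. a)"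
    by (rule \<tau>_linear_continuous) (use P in auto)
  then have "openin TA U" if "openin TF U" for U
  proof -
    have "openin TA {a \<in> topspace TA. a \<in> U}"
      using openin_continuous_map_preimage[OF \<open>continuous_map TA TF (\<lambda>a. a)\<close> that] .
    moreover have "{a \<in> topspace TA. a \<in> U} = U"
      using openin_subset[OF that] topA topF by auto
    ultimately show ?thesis by simp
  qed
  moreover have "openin TF U" if "openin TA U" for U
    using fine_\<sigma> lifting_st_module[OF loc st \<sigma>] that by (auto simp: is_fine_module_topology_def)
  ultimately have "TA = TF" by (auto simp: topology_eq)
  then show ?thesis using \<sigma> by (simp add: precise_lifting_def TF_def)
qed

end
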